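(* Let $L$ be a finite loop of order $n$. There is an isomorphism of vector spaces over $\mathbb{F}_2$ \[\mathcal{C}^2_\delta(L)\cong \mathcal{Z}^2(L)\times \mathcal{C}^1(L).\] As a consequence, \[\dim_{\mathbb{F}_2}\left(\mathcal{C}^2_\delta(L)\right)=\dim_{\mathbb{F}_2}\left(\mathcal{Z}^2(L)\right)+n.\]
   Context: A loop is a set $L$ with a binary operation (written by juxtaposition, not necessarily associative) having an identity element $e$ and such that for all $a,b\in L$ the equations $ax=b$ and $ya=b$ have unique solutions $x,y\in L$. For $k\ge 1$, $\mathcal{C}^k(L)$ is the set of all functions $L^k\to\mathbb{Z}_2$ ($k$-cochains), an $\mathbb{F}_2$-vector space under pointwise addition. $\mathcal{Z}^2(L)$ is the set of $2$-cocycles, i.e. those $\psi\in\mathcal{C}^2(L)$ with $\psi(a,b)+\psi(ab,c)=\psi(a,bc)+\psi(b,c)$ for all $a,b,c\in L$. A pair $(\psi,\phi)\in\mathcal{C}^2(L)\times\mathcal{C}^2(L)$ is $\delta$-compatible over $L$ if $\psi(a,b)+\phi(ab,c)=\phi(a,bc)+\psi(b,c)$ for all $a,b,c\in L$; $\mathcal{C}^2_\delta(L)$ denotes the set of all $\delta$-compatible pairs, with vector space structure inherited from $\mathcal{C}^2(L)\times\mathcal{C}^2(L)$. *)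

theory Defs
  imports
    "HOL-Algebra.Coset"
    "HOL-Analysis.Product_Vector"
    "HOL-Library.Function_Algebras"
    "HOL-Library.Z2"
begin

text \<open>
  A loop is given by the \<^typ>\<open>'a monoid\<close> record (carrier, binary operation, identity);
  associativity is not assumed.
\<close>

locale loop =
  fixes L (structure)
  assumes m_closed: "\<lbrakk>a \<in> carrier L; b \<in> carrier L\<rbrakk> \<Longrightarrow> a \<otimes> b \<in> carrier L"
    and one_closed: "\<one> \<in> carrier L"
    and l_one: "a \<in> carrier L \<Longrightarrow> \<one> \<otimes> a = a"
    and r_one: "a \<in> carrier L \<Longrightarrow> a \<otimes> \<one> = a"
    and l_div: "\<lbrakk>a \<in> carrier L; b \<in> carrier L\<rbrakk> \<Longrightarrow> \<exists>!x. x \<in> carrier L \<and> a \<otimes> x = b"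
    and r_div: "\<lbrakk>a \<in> carrier L; b \<in> carrier L\<rbrakk> \<Longrightarrow> \<exists>!y. y \<in> carrier L \<and> y \<otimes> a = b"

text \<open>
  A function \<open>X \<rightarrow> \<bbbF>\<^sub>2\<close> on a set \<open>X\<close> is represented by its extension by zero to the whole
  type. Extending by zero (rather than by \<^term>\<open>undefined\<close>) makes these functions
  a subspace of the space of all functions on the type.
\<close>

definition maps_to_F2 :: "'x set \<Rightarrow> ('x \<Rightarrow> bit) set"
  where "maps_to_F2 X = {f. \<forall>x. x \<notin> X \<longrightarrow> f x = 0}"

definition C1 :: "('a, 'b) monoid_scheme \<Rightarrow> ('a \<Rightarrow> bit) set"
  where "C1 L = maps_to_F2 (carrier L)"

definition C2 :: "('a, 'b) monoid_scheme \<Rightarrow> ('a \<times> 'a \<Rightarrow> bit) set"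
  where "C2 L = maps_to_F2 (carrier L \<times> carrier L)"

definition Z2 :: "('a, 'b) monoid_scheme \<Rightarrow> ('a \<times> 'a \<Rightarrow> bit) set"
  where "Z2 L = {\<psi> \<in> C2 L. \<forall>a \<in> carrier L. \<forall>b \<in> carrier L. \<forall>c \<in> carrier L.
    \<psi> (a, b) + \<psi> (a \<otimes>\<^bsub>L\<^esub> b, c) = \<psi> (a, b \<otimes>\<^bsub>L\<^esub> c) + \<psi> (b, c)}"

definition delta_compatible ::
    "('a, 'b) monoid_scheme \<Rightarrow> ('a \<times> 'a \<Rightarrow> bit) \<Rightarrow> ('a \<times> 'a \<Rightarrow> bit) \<Rightarrow> bool"
  where "delta_compatible L \<psi> \<phi> \<longleftrightarrow>
    (\<forall>a \<in> carrier L. \<forall>b \<in> carrier L. \<forall>c \<in> carrier L.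
      \<psi> (a, b) + \<phi> (a \<otimes>\<^bsub>L\<^esub> b, c) = \<phi> (a, b \<otimes>\<^bsub>L\<^esub> c) + \<psi> (b, c))"

definition C2_delta ::
    "('a, 'b) monoid_scheme \<Rightarrow> (('a \<times> 'a \<Rightarrow> bit) \<times> ('a \<times> 'a \<Rightarrow> bit)) set"
  where "C2_delta L = {(\<psi>, \<phi>) \<in> C2 L \<times> C2 L. delta_compatible L \<psi> \<phi>}"

definition scale_fun :: "bit \<Rightarrow> ('x \<Rightarrow> bit) \<Rightarrow> 'x \<Rightarrow> bit"
  where "scale_fun c f = (\<lambda>x. c * f x)"

abbreviation scale_prod ::
    "bit \<Rightarrow> ('x \<Rightarrow> bit) \<times> ('y \<Rightarrow> bit) \<Rightarrow> ('x \<Rightarrow> bit) \<times> ('y \<Rightarrow> bit)"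
  where "scale_prod \<equiv> module_prod.scale scale_fun scale_fun"

text \<open>
  Linear isomorphism between subspaces \<open>V\<close> and \<open>W\<close> of two ambient vector spaces with
  scalar multiplications \<open>s\<close> and \<open>t\<close>; nothing is required of the map outside \<open>V\<close>.
\<close>

definition vs_isomorphic ::
    "('k::field \<Rightarrow> 'v::ab_group_add \<Rightarrow> 'v) \<Rightarrow> ('k \<Rightarrow> 'w::ab_group_add \<Rightarrow> 'w) \<Rightarrow>
      'v set \<Rightarrow> 'w set \<Rightarrow> bool"
  where "vs_isomorphic s t V W \<longleftrightarrow>
    (\<exists>T. bij_betw T V W \<and>
      (\<forall>x \<in> V. \<forall>y \<in> V. T (x + y) = T x + T y) \<and>
      (\<forall>c. \<forall>x \<in> V. T (s c x) = t c (T x)))"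

interpretation F2_fun: vector_space scale_fun
  by unfold_locales (auto simp: scale_fun_def fun_eq_iff algebra_simps)

interpretation F2_prod: vector_space_prod scale_fun scale_fun
  by unfold_locales

lemma subspace_C1: "module.subspace scale_fun (C1 L)"
  by (auto simp: F2_fun.subspace_def C1_def maps_to_F2_def scale_fun_def)

lemma add_eq_add_interchange:
  fixes p q r s p' q' r' s' :: "'x::ab_semigroup_add"
  assumes "p + q = r + s" and "p' + q' = r' + s'"
  shows "(p + p') + (q + q') = (r + r') + (s + s')"
proof -
  have "(p + q) + (p' + q') = (r + s) + (r' + s')"
    by (simp only: assms)
  then show ?thesis
    by (simp only: ac_simps)
qed

lemma subspace_Z2: "module.subspace scale_fun (Z2 L)"
proof (rule F2_fun.subspaceI)
  show "0 \<in> Z2 L"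
    by (simp add: Z2_def C2_def maps_to_F2_def)
next
  fix x y assume "x \<in> Z2 L" "y \<in> Z2 L"
  then show "x + y \<in> Z2 L"
    unfolding Z2_def C2_def maps_to_F2_def mem_Collect_eq plus_fun_apply
    by (intro conjI ballI add_eq_add_interchange) simp_all
next
  fix c x assume "x \<in> Z2 L"
  then show "scale_fun c x \<in> Z2 L"
    unfolding Z2_def C2_def maps_to_F2_def mem_Collect_eq scale_fun_def distrib_left [symmetric]
    by simp
qed

lemma subspace_C2_delta: "module.subspace scale_prod (C2_delta L)"
proof (rule F2_prod.p.subspaceI)
  show zero: "0 \<in> C2_delta L"
    by (simp add: C2_delta_def C2_def maps_to_F2_def delta_compatible_def zero_prod_def)
  show "scale_prod c x \<in> C2_delta L" if "x \<in> C2_delta L" for c x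
    using that by (cases c) (simp_all add: zero)
  fix x y assume "x \<in> C2_delta L" "y \<in> C2_delta L"
  moreover obtain \<psi> \<phi> \<psi>' \<phi>' where "x = (\<psi>, \<phi>)" "y = (\<psi>', \<phi>')"
    by (meson surj_pair)
  ultimately show "x + y \<in> C2_delta L"
    unfolding C2_delta_def C2_def maps_to_F2_def delta_compatible_def mem_Collect_eq
      case_prod_conv mem_Times_iff fst_conv snd_conv add_Pair plus_fun_apply
    by (simp only: case_prod_conv mem_Times_iff fst_conv snd_conv add_Pair plus_fun_apply
      mem_Collect_eq, intro conjI ballI add_eq_add_interchange) simp_all
qed

end

theory Submission
  imports Defs
begin

text \<open>
  Write \<open>g c = \<phi> (\<one>, c)\<close>. Putting \<open>a = \<one>\<close> in the compatibility condition expresses \<open>\<phi>\<close>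
  through \<open>\<psi>\<close> and \<open>g\<close>, namely \<open>\<phi> (b, c) = \<psi> (b, c) + g (b c) + \<psi> (\<one>, b)\<close>, and putting
  \<open>b = \<one>\<close> shows that \<open>\<psi> (\<one>, b) = \<psi> (\<one>, \<one>)\<close>. What remains of the condition
  says that \<open>\<psi> + \<delta>g\<close> is a cocycle, where \<open>(\<delta>g) (a, b) = g a + g b + g (a b)\<close>; here
  associativity fails, and the defect \<open>g ((a b) c) + g (a (b c))\<close> of \<open>\<delta>g\<close> is exactly cancelled
  by that of \<open>\<psi>\<close>. Hence \<open>(\<psi>, \<phi>) \<mapsto> (\<psi> + \<delta>g, g)\<close> is the required isomorphism.
\<close>

section \<open>Dimensions of linear images and of products\<close>

lemma (in vector_space_pair) dim_linear_image:
  assumes "Vector_Spaces.linear s1 s2 f" and "inj_on f (vs1.span S)"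
  shows "vs2.dim (f ` S) = vs1.dim S"
proof -
  interpret f: Vector_Spaces.linear s1 s2 f by fact
  obtain B where B: "B \<subseteq> S" "vs1.independent B" "S \<subseteq> vs1.span B" "card B = vs1.dim S"
    by (rule vs1.basis_exists)
  then have span: "vs1.span B = vs1.span S"
    by (metis vs1.span_mono vs1.span_span subset_antisym)
  have "vs2.dim (f ` S) = card (f ` B)"
  proof (rule vs2.dim_eq_card)
    show "vs2.span (f ` B) = vs2.span (f ` S)"
      by (simp add: f.span_image span)
    \<comment> \<open>Independence survives because \<open>f\<close> is injective on all of
      \<open>span B\<close>, which is \<open>span S\<close>.\<close>
    show "vs2.independent (f ` B)"
      using B assms(2) span by (simp add: f.independent_injective_image)
  qed
  also have "\<dots> = card B"
    using assms(2) B(1) by (meson card_image inj_on_subset vs1.span_superset subset_trans)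
  finally show ?thesis
    using B(4) by simp
qed

context vector_space_prod
begin

lemma span_Un_Times: "p.span (A \<times> {0} \<union> {0} \<times> B) = vs1.span A \<times> vs2.span B"
  by (auto simp: p.span_Un span_Times_sing1 span_Times_sing2)

text \<open>Removing one vector shrinks only one of the two factors of the span, so a dependence
  would put \<open>a\<close> in the span of \<open>A - {a}\<close>, or \<open>b\<close> in that of
  \<open>B - {b}\<close>.\<close>

lemma independent_Un_Times:
  assumes "vs1.independent A" and "vs2.independent B"
  shows "p.independent (A \<times> {0} \<union> {0} \<times> B)"
  unfolding p.dependent_def
proof (intro notI, elim bexE)
  fix x
  assume x: "x \<in> A \<times> {0} \<union> {0} \<times> B"
    and span: "x \<in> p.span (A \<times> {0} \<union> {0} \<times> B - {x})"
  from x consider a where "a \<in> A" "x = (a, 0)" | b where "b \<in> B" "x = (0, b)"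
    by blast
  then show False
  proof cases
    case 1
    have "x \<in> p.span ((A - {a}) \<times> {0} \<union> {0} \<times> B)"
      using span by (rule p.span_mono[THEN subsetD, rotated])
        (use 1 assms vs2.dependent_zero in auto)
    then show False
      using 1 assms by (auto simp: span_Un_Times vs1.dependent_def)
  next
    case 2
    have "x \<in> p.span (A \<times> {0} \<union> {0} \<times> (B - {b}))"
      using span by (rule p.span_mono[THEN subsetD, rotated])
        (use 2 assms vs1.dependent_zero in auto)
    then show False
      using 2 assms by (auto simp: span_Un_Times vs2.dependent_def)
  qed
qed

lemma dim_Times_finite:
  assumes "vs1.subspace S" and "vs2.subspace T" and "finite S" and "finite T"
  shows "p.dim (S \<times> T) = vs1.dim S + vs2.dim T"
proof -
  obtain A where A: "A \<subseteq> S" "vs1.independent A" "S \<subseteq> vs1.span A" "card A = vs1.dim S"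
    by (rule vs1.basis_exists)
  obtain B where B: "B \<subseteq> T" "vs2.independent B" "T \<subseteq> vs2.span B" "card B = vs2.dim T"
    by (rule vs2.basis_exists)
  have "finite A" "finite B"
    using A(1) B(1) assms finite_subset by auto
  \<comment> \<open>The two parts of the union could share only \<open>(0, 0)\<close>; this makes
    them disjoint.\<close>
  moreover have "0 \<notin> A"
    using A(2) vs1.dependent_zero by blast
  ultimately have "card (A \<times> {0} \<union> {0} \<times> B) = card A + card B"
    by (subst card_Un_disjoint) (auto simp: card_cartesian_product)
  moreover have "A \<times> {0} \<union> {0} \<times> B \<subseteq> S \<times> T"
    using A(1) B(1) assms(1,2) vs1.subspace_0 vs2.subspace_0 by auto
  moreover have "S \<times> T \<subseteq> p.span (A \<times> {0} \<union> {0} \<times> B)"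
    using A(3) B(3) by (auto simp: span_Un_Times)
  ultimately show ?thesis
    using independent_Un_Times[OF A(2) B(2)] A(4) B(4) by (metis p.dim_unique)
qed

end

section \<open>Functions from a finite set to the two-element field\<close>

lemma scale_prod_apply: "scale_prod c (f, g) = (scale_fun c f, scale_fun c g)"
  by (simp add: F2_prod.scale_def)

text \<open>Such a function is determined by its support, a subset of \<open>X\<close>.\<close>

lemma finite_maps_to_F2:
  assumes "finite X"
  shows "finite (maps_to_F2 X)"
proof -
  have "inj_on (\<lambda>f. {x. f x = 1}) (maps_to_F2 X)"
  proof (intro inj_onI ext)
    fix f g :: "'a \<Rightarrow> bit" and x
    assume "{x. f x = 1} = {x. g x = 1}"
    then have "f x = 1 \<longleftrightarrow> g x = 1"
      by blast
    then show "f x = g x"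
      by (cases "f x"; cases "g x") simp_all
  qed
  moreover have "(\<lambda>f. {x. f x = 1}) ` maps_to_F2 X \<subseteq> Pow X"
    by (auto simp: maps_to_F2_def)
  ultimately show ?thesis
    using assms by (meson finite_Pow_iff inj_on_finite)
qed

text \<open>The indicator functions \<open>e x\<close> of the points of \<open>X\<close> form a
  basis. Evaluating a combination at a point of \<open>X\<close> returns its coefficient there,
  which yields both spanning and independence.\<close>

lemma dim_maps_to_F2:
  assumes "finite X"
  shows "F2_fun.dim (maps_to_F2 X) = card X"
proof -
  define e :: "'a \<Rightarrow> 'a \<Rightarrow> bit" where "e x = (\<lambda>y. if y = x then 1 else 0)" for x
  have sum_e: "(\<Sum>x\<in>X. scale_fun (u x) (e x)) y = (if y \<in> X then u y else 0)" for u y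
  proof -
    have "(\<Sum>x\<in>X. scale_fun (u x) (e x)) y = (\<Sum>x\<in>X. scale_fun (u x) (e x) y)"
      using assms by (induction X rule: finite_induct) auto
    also have "\<dots> = (\<Sum>x\<in>X. if x = y then u x else 0)"
      by (intro sum.cong) (auto simp: scale_fun_def e_def)
    finally show ?thesis
      using assms by simp
  qed
  have inj: "inj_on e X"
  proof (rule inj_onI)
    fix x y
    assume "e x = e y"
    then have "e x x = e y x"
      by simp
    then show "x = y"
      by (simp add: e_def split: if_splits)
  qed
  show ?thesis
  proof (rule F2_fun.dim_unique)
    show "e ` X \<subseteq> maps_to_F2 X"
      by (auto simp: e_def maps_to_F2_def)
    show "maps_to_F2 X \<subseteq> F2_fun.span (e ` X)"
    proof
      fix f :: "'a \<Rightarrow> bit"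
      assume "f \<in> maps_to_F2 X"
      then have "f = (\<Sum>x\<in>X. scale_fun (f x) (e x))"
        by (auto simp: fun_eq_iff sum_e maps_to_F2_def)
      also have "\<dots> \<in> F2_fun.span (e ` X)"
        by (intro F2_fun.span_sum F2_fun.span_scale F2_fun.span_base imageI)
      finally show "f \<in> F2_fun.span (e ` X)" .
    qed
    show "F2_fun.independent (e ` X)"
    proof (rule F2_fun.independent_if_scalars_zero)
      fix u v
      assume "(\<Sum>v\<in>e ` X. scale_fun (u v) v) = 0" and v: "v \<in> e ` X"
      then have "(\<Sum>x\<in>X. scale_fun (u (e x)) (e x)) = 0"
        by (simp add: sum.reindex[OF inj])
      then have "u (e x) = 0" if "x \<in> X" for x
        using that sum_e[of "u \<circ> e" x] by simp
      then show "u v = 0"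
        using v by blast
    qed (use assms in simp)
    show "card (e ` X) = card X"
      using inj by (rule card_image)
  qed
qed

section \<open>The two maps and the linearity of the first\<close>

definition coboundary :: "('a, 'b) monoid_scheme \<Rightarrow> ('a \<Rightarrow> bit) \<Rightarrow> 'a \<times> 'a \<Rightarrow> bit"
  where "coboundary L g = (\<lambda>(a, b).
    if a \<in> carrier L \<and> b \<in> carrier L then g a + g b + g (a \<otimes>\<^bsub>L\<^esub> b) else 0)"

definition delta_to_prod :: "('a, 'b) monoid_scheme \<Rightarrow>
    ('a \<times> 'a \<Rightarrow> bit) \<times> ('a \<times> 'a \<Rightarrow> bit) \<Rightarrow> ('a \<times> 'a \<Rightarrow> bit) \<times> ('a \<Rightarrow> bit)"
  where "delta_to_prod L = (\<lambda>(\<psi>, \<phi>).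
    (\<psi> + coboundary L (\<lambda>x. \<phi> (\<one>\<^bsub>L\<^esub>, x)), \<lambda>x. \<phi> (\<one>\<^bsub>L\<^esub>, x)))"

text \<open>With \<psi> = \<theta> + \<delta>g, the second component is \<psi>(a,b) + g(ab) +
  \<psi>(\<one>,\<one>) simplified: g(ab) cancels against the one in \<delta>g(a,b), and
  \<delta>g(\<one>,\<one>) = g(\<one>).\<close>

definition prod_to_delta :: "('a, 'b) monoid_scheme \<Rightarrow>
    ('a \<times> 'a \<Rightarrow> bit) \<times> ('a \<Rightarrow> bit) \<Rightarrow> ('a \<times> 'a \<Rightarrow> bit) \<times> ('a \<times> 'a \<Rightarrow> bit)"
  where "prod_to_delta L = (\<lambda>(\<theta>, g). (\<theta> + coboundary L g, \<lambda>(a, b).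
    if a \<in> carrier L \<and> b \<in> carrier L
    then \<theta> (a, b) + g a + g b + \<theta> (\<one>\<^bsub>L\<^esub>, \<one>\<^bsub>L\<^esub>) + g \<one>\<^bsub>L\<^esub> else 0))"

lemma bit_add_self: "x + x = (0::bit)"
  by (cases x) simp_all

text \<open>These simp rules turn \<open>+\<close> into \<open>XOR\<close> and then into case distinctions, which blocks ring reasoning.\<close>

declare add_bit_eq_xor [simp del] mult_bit_eq_and [simp del]

text \<open>In a sorted sum nested to the right, a pair of equal terms appears in this form unless
  it comes last.\<close>

lemma bit_add_left_cancel_self: "x + (x + y) = (y::bit)"
  by (simp add: bit_add_self flip: add.assoc)

lemmas bit_sum_simps = add.assoc add.commute add.left_commute bit_add_self bit_add_left_cancel_self

lemma coboundary_add: "coboundary L (\<lambda>x. f x + g x) = coboundary L f + coboundary L g"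
  by (simp add: coboundary_def fun_eq_iff ac_simps)

lemma coboundary_scale: "coboundary L (\<lambda>x. c * g x) = scale_fun c (coboundary L g)"
  by (simp add: coboundary_def scale_fun_def fun_eq_iff distrib_left)

text \<open>Evaluation at \<open>(\<one>, x)\<close> and \<open>coboundary\<close> are linear on all
  functions, so linearity holds on the whole ambient space.\<close>

lemma linear_delta_to_prod: "Vector_Spaces.linear scale_prod scale_prod (delta_to_prod L)"
  unfolding Vector_Spaces.linear_iff
proof (intro conjI allI)
  show "delta_to_prod L (x + y) = delta_to_prod L x + delta_to_prod L y" for x y
    by (cases x, cases y) (simp add: delta_to_prod_def coboundary_add fun_eq_iff ac_simps)
  show "delta_to_prod L (scale_prod c x) = scale_prod c (delta_to_prod L x)" for c x
    by (cases x)
      (simp add: delta_to_prod_def scale_prod_apply scale_fun_def coboundary_scale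
        fun_eq_iff distrib_left)
qed (rule F2_prod.p.vector_space_axioms)+

lemma Z2D:
  assumes "\<psi> \<in> Z2 L" and "a \<in> carrier L" and "b \<in> carrier L" and "c \<in> carrier L"
  shows "\<psi> (a, b) + \<psi> (a \<otimes>\<^bsub>L\<^esub> b, c) = \<psi> (a, b \<otimes>\<^bsub>L\<^esub> c) + \<psi> (b, c)"
  using assms unfolding Z2_def by blast

lemma C2_deltaD:
  assumes "(\<psi>, \<phi>) \<in> C2_delta L" and "a \<in> carrier L" and "b \<in> carrier L" and "c \<in> carrier L"
  shows "\<psi> (a, b) + \<phi> (a \<otimes>\<^bsub>L\<^esub> b, c) = \<phi> (a, b \<otimes>\<^bsub>L\<^esub> c) + \<psi> (b, c)"
  using assms unfolding C2_delta_def delta_compatible_def by blast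

section \<open>Compatible pairs over a loop and the bijection\<close>

context loop
begin

text \<open>In the condition at (\<one>,\<one>,b) the term \<phi>(\<one>,b) stands on both sides and
  cancels.\<close>

lemma C2_delta_one:
  assumes "(\<psi>, \<phi>) \<in> C2_delta L" and "b \<in> carrier L"
  shows "\<psi> (\<one>, b) = \<psi> (\<one>, \<one>)"
  using C2_deltaD[OF assms(1) one_closed one_closed assms(2)] assms(2) one_closed
  by (simp add: l_one add.commute[of "\<psi> (\<one>, \<one>)"])

text \<open>A cocycle \<theta> gives the compatible pair (\<theta>,\<theta>).\<close>

lemma Z2_one:
  assumes "\<theta> \<in> Z2 L" and "b \<in> carrier L"
  shows "\<theta> (\<one>, b) = \<theta> (\<one>, \<one>)"
  using assms by (intro C2_delta_one[of \<theta> \<theta>])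
    (auto simp: Z2_def C2_delta_def delta_compatible_def)

lemma C2_delta_snd:
  assumes "(\<psi>, \<phi>) \<in> C2_delta L" and "b \<in> carrier L" and "c \<in> carrier L"
  shows "\<phi> (b, c) = \<psi> (b, c) + \<phi> (\<one>, b \<otimes> c) + \<psi> (\<one>, \<one>)"
proof -
  have "\<psi> (\<one>, \<one>) + \<phi> (b, c) = \<phi> (\<one>, b \<otimes> c) + \<psi> (b, c)"
    using C2_deltaD[OF assms(1) one_closed assms(2,3)] C2_delta_one[OF assms(1,2)]
    by (simp add: l_one assms(2))
  then have "\<psi> (\<one>, \<one>) + (\<psi> (\<one>, \<one>) + \<phi> (b, c)) =
      \<psi> (\<one>, \<one>) + (\<phi> (\<one>, b \<otimes> c) + \<psi> (b, c))"
    by (rule arg_cong)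
  then show ?thesis
    by (simp add: bit_sum_simps)
qed

lemma delta_to_prod_mem:
  assumes "x \<in> C2_delta L"
  shows "delta_to_prod L x \<in> Z2 L \<times> C1 L"
proof -
  obtain \<psi> \<phi> where x: "x = (\<psi>, \<phi>)"
    by fastforce
  define g where "g = (\<lambda>x. \<phi> (\<one>, x))"
  have mem: "(\<psi>, \<phi>) \<in> C2_delta L"
    using assms x by simp
  then have "g \<in> C1 L" "\<psi> + coboundary L g \<in> C2 L"
    by (auto simp: g_def C2_delta_def C2_def C1_def maps_to_F2_def coboundary_def)
  moreover have "(\<psi> + coboundary L g) (a, b) + (\<psi> + coboundary L g) (a \<otimes> b, c) =
      (\<psi> + coboundary L g) (a, b \<otimes> c) + (\<psi> + coboundary L g) (b, c)"
    if abc: "a \<in> carrier L" "b \<in> carrier L" "c \<in> carrier L" for a b c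
  proof -
    \<comment> \<open>Eliminating both values of \<phi> by \<open>C2_delta_snd\<close> puts
      \<psi>(\<one>,\<one>) on each side, where it cancels.\<close>
    have "\<psi> (a, b) + (\<psi> (a \<otimes> b, c) + g (a \<otimes> b \<otimes> c) + \<psi> (\<one>, \<one>)) =
        (\<psi> (a, b \<otimes> c) + g (a \<otimes> (b \<otimes> c)) + \<psi> (\<one>, \<one>)) + \<psi> (b, c)"
      using C2_deltaD[OF mem abc]
      unfolding C2_delta_snd[OF mem m_closed[OF abc(1,2)] abc(3)]
        C2_delta_snd[OF mem abc(1) m_closed[OF abc(2,3)]]
      by (simp only: g_def)
    then have "\<psi> (a, b) + \<psi> (a \<otimes> b, c) + g (a \<otimes> b \<otimes> c) =
        \<psi> (a, b \<otimes> c) + \<psi> (b, c) + g (a \<otimes> (b \<otimes> c))"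
      by (simp add: ac_simps)
    \<comment> \<open>The added terms complete the coboundaries: g(ab) occurs twice on the left and
      g(bc) twice on the right, so these vanish.\<close>
    then have "(\<psi> (a, b) + \<psi> (a \<otimes> b, c) + g (a \<otimes> b \<otimes> c)) + (g a + g b + g c) =
        (\<psi> (a, b \<otimes> c) + \<psi> (b, c) + g (a \<otimes> (b \<otimes> c))) + (g a + g b + g c)"
      by simp
    then show ?thesis
      using abc by (simp add: coboundary_def m_closed bit_sum_simps)
  qed
  ultimately show ?thesis
    by (simp add: x delta_to_prod_def Z2_def g_def)
qed

text \<open>Since \<phi> contains no g of a product, no g of a triple product arises; g(ab) and
  g(bc) each occur twice, leaving the cocycle identity plus a common sum.\<close>

lemma prod_to_delta_mem:
  assumes "y \<in> Z2 L \<times> C1 L"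
  shows "prod_to_delta L y \<in> C2_delta L"
proof -
  obtain \<theta> g where y: "y = (\<theta>, g)"
    by fastforce
  have mem: "\<theta> \<in> Z2 L"
    using assms y by simp
  obtain \<psi> \<phi> where eq: "prod_to_delta L y = (\<psi>, \<phi>)"
    by fastforce
  have "\<psi> (a, b) + \<phi> (a \<otimes> b, c) = \<phi> (a, b \<otimes> c) + \<psi> (b, c)"
    if abc: "a \<in> carrier L" "b \<in> carrier L" "c \<in> carrier L" for a b c
  proof -
    have "\<theta> (a, b) + \<theta> (a \<otimes> b, c) = \<theta> (a, b \<otimes> c) + \<theta> (b, c)"
      using mem abc by (rule Z2D)
    then have "(\<theta> (a, b) + \<theta> (a \<otimes> b, c)) + (g a + g b + g c + \<theta> (\<one>, \<one>) + g \<one>) =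
        (\<theta> (a, b \<otimes> c) + \<theta> (b, c)) + (g a + g b + g c + \<theta> (\<one>, \<one>) + g \<one>)"
      by simp
    then show ?thesis
      using eq abc by (auto simp: y prod_to_delta_def coboundary_def m_closed bit_sum_simps)
  qed
  moreover have "\<psi> \<in> C2 L" "\<phi> \<in> C2 L"
    using mem eq by (auto simp: y prod_to_delta_def coboundary_def Z2_def C2_def maps_to_F2_def)
  ultimately show ?thesis
    by (simp add: eq C2_delta_def delta_compatible_def)
qed

lemma prod_to_delta_inverse:
  assumes "x \<in> C2_delta L"
  shows "prod_to_delta L (delta_to_prod L x) = x"
proof -
  obtain \<psi> \<phi> where x: "x = (\<psi>, \<phi>)"
    by fastforce
  have mem: "(\<psi>, \<phi>) \<in> C2_delta L"
    using assms x by simp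
  define g where "g = (\<lambda>x. \<phi> (\<one>, x))"
  have "fst (prod_to_delta L (delta_to_prod L x)) = \<psi>"
    by (simp add: x prod_to_delta_def delta_to_prod_def fun_eq_iff bit_sum_simps)
  moreover have "snd (prod_to_delta L (delta_to_prod L x)) (a, b) = \<phi> (a, b)" for a b
  proof (cases "a \<in> carrier L \<and> b \<in> carrier L")
    case True
    then have "\<phi> (a, b) = \<psi> (a, b) + g (a \<otimes> b) + \<psi> (\<one>, \<one>)"
      unfolding g_def by (intro C2_delta_snd[OF mem]) auto
    then show ?thesis
      \<comment> \<open>Here \<theta>(\<one>,\<one>) = \<psi>(\<one>,\<one>) + g(\<one>), so the
        correction \<theta>(\<one>,\<one>) + g(\<one>) is the constant
        \<psi>(\<one>,\<one>).\<close>
      using True one_closed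
      by (simp add: x prod_to_delta_def delta_to_prod_def coboundary_def l_one
          bit_sum_simps flip: g_def[THEN fun_cong])
  next
    case False
    then have "\<phi> (a, b) = 0"
      using mem by (auto simp: C2_delta_def C2_def maps_to_F2_def)
    then show ?thesis
      using False by (auto simp: x prod_to_delta_def delta_to_prod_def)
  qed
  ultimately show ?thesis
    by (auto simp: x prod_eq_iff fun_eq_iff)
qed

lemma delta_to_prod_inverse:
  assumes "y \<in> Z2 L \<times> C1 L"
  shows "delta_to_prod L (prod_to_delta L y) = y"
proof -
  obtain \<theta> g where y: "y = (\<theta>, g)"
    by fastforce
  have mem: "\<theta> \<in> Z2 L" "g \<in> C1 L"
    using assms y by simp_all
  have "snd (prod_to_delta L y) (\<one>, x) = g x" for x
  proof (cases "x \<in> carrier L")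
    case True
    then show ?thesis
      \<comment> \<open>The terms \<theta>(\<one>,x) and \<theta>(\<one>,\<one>) cancel, as do the
        two copies of g(\<one>).\<close>
      using Z2_one[OF mem(1) True] one_closed
      by (simp add: y prod_to_delta_def bit_sum_simps)
  next
    case False
    then show ?thesis
      using mem by (simp add: y prod_to_delta_def C1_def maps_to_F2_def)
  qed
  then have "(\<lambda>x. snd (prod_to_delta L y) (\<one>, x)) = g"
    by blast
  then have "delta_to_prod L (prod_to_delta L y) = (\<theta> + coboundary L g + coboundary L g, g)"
    by (simp add: delta_to_prod_def y prod_to_delta_def)
  then show ?thesis
    by (simp add: y fun_eq_iff bit_sum_simps)
qed

lemma bij_betw_delta_to_prod: "bij_betw (delta_to_prod L) (C2_delta L) (Z2 L \<times> C1 L)"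
proof (rule bij_betw_byWitness)
  show "\<forall>x\<in>C2_delta L. prod_to_delta L (delta_to_prod L x) = x"
    using prod_to_delta_inverse by blast
  show "\<forall>y\<in>Z2 L \<times> C1 L. delta_to_prod L (prod_to_delta L y) = y"
    using delta_to_prod_inverse by blast
  show "delta_to_prod L ` C2_delta L \<subseteq> Z2 L \<times> C1 L"
    using delta_to_prod_mem by blast
  show "prod_to_delta L ` (Z2 L \<times> C1 L) \<subseteq> C2_delta L"
    using prod_to_delta_mem by blast
qed

end

theorem theorem11:
  fixes L :: "('a, 'b) monoid_scheme" and n :: nat
  assumes "loop L"
    and "finite (carrier L)"
    and "order L = n"
  shows "vs_isomorphic scale_prod scale_prod (C2_delta L) (Z2 L \<times> C1 L) \<and>
    vector_space.dim scale_prod (C2_delta L) = vector_space.dim scale_fun (Z2 L) + n"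
proof
  have bij: "bij_betw (delta_to_prod L) (C2_delta L) (Z2 L \<times> C1 L)"
    using assms(1) by (rule loop.bij_betw_delta_to_prod)
  interpret T: Vector_Spaces.linear scale_prod scale_prod "delta_to_prod L"
    by (rule linear_delta_to_prod)
  show "vs_isomorphic scale_prod scale_prod (C2_delta L) (Z2 L \<times> C1 L)"
    unfolding vs_isomorphic_def using bij T.add T.scale by blast
  interpret P: vector_space_pair
    "scale_prod :: bit \<Rightarrow> ('a \<times> 'a \<Rightarrow> bit) \<times> ('a \<times> 'a \<Rightarrow> bit) \<Rightarrow> _"
    "scale_prod :: bit \<Rightarrow> ('a \<times> 'a \<Rightarrow> bit) \<times> ('a \<Rightarrow> bit) \<Rightarrow> _"
    by unfold_locales
  have "finite (Z2 L)" "finite (C1 L)"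
    using assms(2) finite_maps_to_F2[of "carrier L \<times> carrier L"] finite_maps_to_F2[of "carrier L"]
    by (auto simp: Z2_def C2_def C1_def)
  then have "F2_prod.p.dim (Z2 L \<times> C1 L) = F2_fun.dim (Z2 L) + F2_fun.dim (C1 L)"
    by (intro F2_prod.dim_Times_finite subspace_Z2 subspace_C1)
  moreover have "F2_prod.p.dim (Z2 L \<times> C1 L) = F2_prod.p.dim (C2_delta L)"
    \<comment> \<open>A subspace is its own span, so injectivity on \<open>C2_delta L\<close>
      suffices.\<close>
    using P.dim_linear_image[OF linear_delta_to_prod, of L "C2_delta L"] bij
    by (simp add: bij_betw_def F2_prod.p.span_eq_iff[THEN iffD2, OF subspace_C2_delta])
  moreover have "F2_fun.dim (C1 L) = n"
    using assms(2,3) by (simp add: C1_def dim_maps_to_F2 order_def)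
  ultimately show "F2_prod.p.dim (C2_delta L) = F2_fun.dim (Z2 L) + n"
    by simp
qed

end
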